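(* Let $N\ge2$, $\gamma\in(\frac1{N+1},\frac1N]$ and $\beta>\frac1N$. For $k\in\{0,1\}$ let $f_{e_k}\in C^{N-1}_b(\mathbb R;\mathbb R)$ be such that $f_{e_k}^{(k)}(0)=1$ and $f_{e_k}^{(j)}(0)=0$ for all $j\in\{0,\dots,N-1\}\setminus\{k\}$. Define $\phi$ with values in $\mathbb R^N$, for $x=(x_1,\dots,x_N)$ with $x_1>0$, by $$\phi(x)_k=\begin{cases}x_1^\beta f_{e_1}(x_{k+1}),&k<N,\\ x_1^\beta f_{e_0}(x_N),&k=N.\end{cases}$$ Let $\mathbf X$ be the branched rough path over $\mathbb R$ (i.e. $d=1$) given by $\mathbf X_t=\mathbf 1+t\,[\cdot]^N(\mathbf 1)$, where $[\cdot]^N(\mathbf 1)$ is the linear (single-branch) tree with $N$ vertices; that is, $\langle\mathbf X_t,\mathbf 1\rangle=1$, $\langle\mathbf X_t,[\cdot]^N(\mathbf 1)\rangle=t$, and $\langle\mathbf X_t,h\rangle=0$ for all other forests $h$ with $1\le|h|\le N$. Then the branched rough differential equation $$\mathrm d\mathbf Y_t=\phi(\mathbf Y_t)\,\mathrm d\mathbf X_t,\qquad Y_0=(1,0,\dots,0)\in\mathbb R^N,$$ explodes in finite time.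
   Context: Trees and forests ($d=1$, so labels are omitted). $\mathcal T$ is the set of finite (non-planar) rooted trees, together with the empty tree $\mathbf 1$; $\mathcal F$ is the set of forests, i.e. finite commutative products (repetitions allowed) of nonempty trees, the empty product being $\mathbf 1$. $|f|$ is the number of vertices and $\#f$ the number of trees counted with multiplicity; $\mathcal F_n=\{f\in\mathcal F:|f|\le n\}$. $[f]$ is the tree obtained by joining the roots of all trees in $f$ to a new root, and $[\cdot]^N$ is its $N$-fold application. Hopf algebra. $\mathcal H$ is the real vector space with basis $\mathcal F$ and the product of forests. The coproduct $\Delta$ is the algebra morphism with $\Delta\mathbf 1=\mathbf 1\otimes\mathbf 1$ and $\Delta[f]=[f]\otimes\mathbf 1+(\mathrm{id}\otimes[\cdot])\Delta f$. For linear functionals $x,y$ on $\mathcal H$, $\langle x\star y,h\rangle=\langle x\otimes y,\Delta h\rangle$. $G_N$ is the group (under $\star$) of characters of $\mathcal H$, modulo identification of characters agreeing on $\mathcal F_N$. A $\gamma$-Hölder branched rough path on $[0,T]$ is a map $\mathbf X:[0,T]\to G_N$ such that, with $\mathbf X_{st}:=\mathbf X_s^{-1}\star\mathbf X_t$, $\sup_{s<t}|\langle\mathbf X_{st},f\rangle|/|t-s|^{\gamma|f|}<\infty$ for all $f\in\mathcal F_N$. The $\mathbf X$ of the claim is such a path on every $[0,T]$. Controlled rough path. On an interval $J\subseteq[0,\infty)$, an $\mathbb R^m$-valued $\mathbf X$-controlled rough path is a family $(\partial^f_XY)_{f\in\mathcal F_{N-1}}$ of paths $J\to\mathbb R^m$,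 $Y_t:=\partial^{\mathbf 1}_XY_t$, such that $R^{\mathbf Y,f}_{st}:=\partial^f_XY_t-\sum_{g\in\mathcal F_{N-1}}\langle\mathbf X_{st}\otimes f,\Delta g\rangle\partial^g_XY_s$ satisfies $\sup|R^{\mathbf Y,f}_{st}|/|t-s|^{(N-|f|)\gamma}<\infty$ over $s<t$ in each compact subinterval of $J$, for each $f\in\mathcal F_{N-1}$. For $f\in\mathcal F_{N-1}$, $\partial^f_X\phi(\mathbf Y)=\sum_{\tau_1\cdots\tau_{\#f}=f}\frac1{(\#f)!}D^{\#f}\phi(Y)[\partial_X^{\tau_1}Y,\dots,\partial_X^{\tau_{\#f}}Y]$ (sum over ordered tuples of nonempty trees with product $f$). The rough integral is $\int_s^t\phi(\mathbf Y_r)\,\mathrm d\mathbf X_r=\lim_{|\mathcal P|\to0}\sum_{(u,v)\in\mathcal P}\sum_{f\in\mathcal F_{N-1}}\partial^f_X\phi(\mathbf Y_u)\langle\mathbf X_{uv},[f]\rangle$. Solution. $\mathbf Y$ is a solution on $J\ni0$ if $Y_t=Y_0+\int_0^t\phi(\mathbf Y_s)\,\mathrm d\mathbf X_s$ for $t\in J$, $\partial^{[f]}_XY=\partial^f_X\phi(\mathbf Y)$ for all $f\in\mathcal F_{N-2}$, and $\partial^f_XY=0$ for $f\in\mathcal F_{N-1}$ with $\#f\ge2$. The equation explodes in finite time if there are $\xi\in(0,\infty)$ and a solution on $[0,\xi)$ from the given initial condition with $\|Y_t\|\to\infty$ as $t\uparrow\xi$. $C^n_b$ denotes functions with bounded continuous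 derivatives up to order $n$. *)

theory Defs
  imports
    "HOL-Analysis.Analysis"
    "HOL-Algebra.Group"
    "HOL-Library.Multiset"
    "HOL-Library.Poly_Mapping"
    "HOL-Library.Product_Plus"
begin

text \<open>A non-planar rooted tree is its root together with the multiset of its branches.  A forest
  is a multiset of nonempty trees; the product of forests is \<open>+\<close>, the empty forest
  (identified with the empty tree) is \<open>{#}\<close>, and the number of trees in \<open>f\<close>
  is \<open>size f\<close>.\<close>

datatype tree = Node "tree multiset"

type_synonym forest = "tree multiset"

primrec tree_vertices :: "tree \<Rightarrow> nat" where
  "tree_vertices (Node f) = Suc (\<Sum>\<^sub># (image_mset tree_vertices f))"

definition vertices :: "forest \<Rightarrow> nat" where
  "vertices f = (\<Sum>\<tau>\<in>#f. tree_vertices \<tau>)"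

definition graft :: "forest \<Rightarrow> forest" where
  "graft f = {#Node f#}"

definition forests :: "nat \<Rightarrow> forest set" where
  "forests n = {f. vertices f \<le> n}"

lemma vertices_simps [simp]:
  "vertices {#} = 0" "vertices (f + g) = vertices f + vertices g"
  "vertices (add_mset \<tau> f) = tree_vertices \<tau> + vertices f"
  "tree_vertices (Node f) = Suc (vertices f)" "vertices (graft f) = Suc (vertices f)"
  by (simp_all add: vertices_def graft_def)

declare tree_vertices.simps [simp del]

lemma size_le_vertices: "size f \<le> vertices f"
proof (induction f)
  case (add \<tau> f)
  then show ?case by (cases \<tau>) simp
qed simp

lemma finite_forests: "finite (forests n)"
proof (induction n)
  case 0
  have "f = {#}" if "vertices f \<le> 0" for f
    using size_le_vertices[of f] that by simp
  then have "forests 0 \<subseteq> {{#}}" by (auto simp: forests_def)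
  then show ?case by (rule finite_subset) simp
next
  case (Suc n)
  let ?L = "{xs. set xs \<subseteq> Node ` forests n \<and> length xs \<le> Suc n}"
  have "f \<in> mset ` ?L" if f: "f \<in> forests (Suc n)" for f
  proof -
    obtain xs where xs: "mset xs = f" using ex_mset by blast
    have "length xs \<le> Suc n"
      using size_le_vertices[of f] f xs by (auto simp: forests_def)
    moreover have "\<tau> \<in> Node ` forests n" if "\<tau> \<in> set xs" for \<tau>
    proof -
      obtain g where g: "\<tau> = Node g" by (cases \<tau>)
      have "\<tau> \<in># f" using that xs by auto
      then obtain f' where "f = add_mset \<tau> f'" by (meson multi_member_split)
      then have "Suc (vertices g) \<le> Suc n" using f g by (simp add: forests_def)
      then show ?thesis using g by (auto simp: forests_def)
    qed
    ultimately show ?thesis using xs by auto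
  qed
  then have "forests (Suc n) \<subseteq> mset ` ?L" by blast
  moreover have "finite ?L" using Suc.IH by (intro finite_lists_length_le) simp
  ultimately show ?case by (meson finite_imageI finite_subset)
qed

text \<open>The algebra spanned by the forests is the monoid algebra of finitely supported functions on
  forests, and its tensor square is the monoid algebra over pairs of forests, in which \<open>*\<close>
  is the product of the tensor product algebra and \<open>a \<otimes> b\<close> is
  \<open>Poly_Mapping.single (a, b) 1\<close>.\<close>

type_synonym tensor = "(forest \<times> forest) \<Rightarrow>\<^sub>0 real"

definition id_tensor_graft :: "tensor \<Rightarrow> tensor" where
  "id_tensor_graft h =
     (\<Sum>(a, b)\<in>Poly_Mapping.keys h.
        Poly_Mapping.single (a, graft b) (Poly_Mapping.lookup h (a, b)))"

primrec tree_coproduct :: "tree \<Rightarrow> tensor" where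
  "tree_coproduct (Node f) =
     Poly_Mapping.single (graft f, {#}) 1
     + id_tensor_graft (\<Prod>\<^sub># (image_mset tree_coproduct f))"

definition coproduct :: "forest \<Rightarrow> tensor" where
  "coproduct f = (\<Prod>\<tau>\<in>#f. tree_coproduct \<tau>)"

lemma coproduct_empty: "coproduct {#} = Poly_Mapping.single ({#}, {#}) 1"
  by (simp add: coproduct_def flip: single_one zero_prod_def)

lemma coproduct_mult: "coproduct (f + g) = coproduct f * coproduct g"
  by (simp add: coproduct_def)

lemma coproduct_graft:
  "coproduct (graft f) = Poly_Mapping.single (graft f, {#}) 1 + id_tensor_graft (coproduct f)"
  by (simp add: coproduct_def graft_def)

text \<open>A linear functional on the algebra is represented by its values on the basis of forests.\<close>

type_synonym functional = "forest \<Rightarrow> real"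

definition tensor_pairing ::
    "functional \<Rightarrow> functional \<Rightarrow> tensor \<Rightarrow> real" where
  "tensor_pairing x y h =
     (\<Sum>(a, b)\<in>Poly_Mapping.keys h. Poly_Mapping.lookup h (a, b) * (x a * y b))"

definition star :: "functional \<Rightarrow> functional \<Rightarrow> functional" where
  "star x y = (\<lambda>f. tensor_pairing x y (coproduct f))"

definition dual :: "forest \<Rightarrow> functional" where
  "dual f = (\<lambda>h. if h = f then 1 else 0)"

definition is_character :: "functional \<Rightarrow> bool" where
  "is_character x \<longleftrightarrow> x {#} = 1 \<and> (\<forall>f g. x (f + g) = x f * x g)"

text \<open>The class of a character modulo agreement on \<open>forests N\<close> is represented by the
  functional that agrees with it there and vanishes on all other forests.\<close>

definition truncate :: "nat \<Rightarrow> functional \<Rightarrow> functional" where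
  "truncate N x = (\<lambda>f. if f \<in> forests N then x f else 0)"

definition char_group :: "nat \<Rightarrow> functional monoid" where
  "char_group N =
     \<lparr>carrier = truncate N ` Collect is_character,
      mult = (\<lambda>x y. truncate N (star x y)),
      one = dual {#}\<rparr>"

definition increment :: "nat \<Rightarrow> (real \<Rightarrow> functional) \<Rightarrow> real \<Rightarrow> real \<Rightarrow> functional" where
  "increment N X s t = inv\<^bsub>char_group N\<^esub> (X s) \<otimes>\<^bsub>char_group N\<^esub> X t"

definition branched_rough_path :: "nat \<Rightarrow> real \<Rightarrow> real \<Rightarrow> (real \<Rightarrow> functional) \<Rightarrow> bool" where
  "branched_rough_path N \<gamma> T X \<longleftrightarrow>
     (\<forall>t\<in>{0..T}. X t \<in> carrier (char_group N)) \<and>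
     (\<forall>f\<in>forests N. \<exists>C. \<forall>s t. 0 \<le> s \<longrightarrow> s < t \<longrightarrow> t \<le> T \<longrightarrow>
        \<bar>increment N X s t f\<bar> / \<bar>t - s\<bar> powr (\<gamma> * real (vertices f)) \<le> C)"

text \<open>A family of paths \<open>Y\<close> has \<open>Y f t\<close> as its component
  \<open>\<partial>\<^sup>f Y\<close> at time \<open>t\<close>; only \<open>f \<in> forests (N - 1)\<close> is relevant.\<close>

definition remainder ::
    "nat \<Rightarrow> (real \<Rightarrow> functional) \<Rightarrow> (forest \<Rightarrow> real \<Rightarrow> 'a::euclidean_space) \<Rightarrow>
     forest \<Rightarrow> real \<Rightarrow> real \<Rightarrow> 'a" where
  "remainder N X Y f s t =
     Y f t - (\<Sum>g\<in>forests (N - 1).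
                tensor_pairing (increment N X s t) (dual f) (coproduct g) *\<^sub>R Y g s)"

definition controlled_rough_path ::
    "nat \<Rightarrow> real \<Rightarrow> (real \<Rightarrow> functional) \<Rightarrow> real set \<Rightarrow>
     (forest \<Rightarrow> real \<Rightarrow> 'a::euclidean_space) \<Rightarrow> bool" where
  "controlled_rough_path N \<gamma> X J Y \<longleftrightarrow>
     (\<forall>f\<in>forests (N - 1). \<forall>a b. {a..b} \<subseteq> J \<longrightarrow>
        (\<exists>C. \<forall>s t. a \<le> s \<longrightarrow> s < t \<longrightarrow> t \<le> b \<longrightarrow>
           norm (remainder N X Y f s t)
             / \<bar>t - s\<bar> powr ((real N - real (vertices f)) * \<gamma>) \<le> C))"

text \<open>\<open>iterated_deriv \<phi> [v\<^sub>1, \<dots>, v\<^sub>n] y\<close> is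
  \<open>D\<^sup>n \<phi>(y)[v\<^sub>1, \<dots>, v\<^sub>n]\<close>.\<close>

fun iterated_deriv ::
    "('a::real_normed_vector \<Rightarrow> 'b::real_normed_vector) \<Rightarrow> 'a list \<Rightarrow> 'a \<Rightarrow> 'b" where
  "iterated_deriv \<phi> [] y = \<phi> y"
| "iterated_deriv \<phi> (v # vs) y = frechet_derivative (iterated_deriv \<phi> vs) (at y) v"

definition comp_deriv ::
    "('a::euclidean_space \<Rightarrow> 'a) \<Rightarrow> (forest \<Rightarrow> real \<Rightarrow> 'a) \<Rightarrow> forest \<Rightarrow> real \<Rightarrow> 'a" where
  "comp_deriv \<phi> Y f t =
     (\<Sum>\<tau>s\<in>{\<tau>s. mset \<tau>s = f}.
        (1 / fact (size f)) *\<^sub>R iterated_deriv \<phi> (map (\<lambda>\<tau>. Y {#\<tau>#} t) \<tau>s) (Y {#} t))"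

definition is_partition :: "real \<Rightarrow> real \<Rightarrow> real list \<Rightarrow> bool" where
  "is_partition s t ps \<longleftrightarrow> ps \<noteq> [] \<and> hd ps = s \<and> last ps = t \<and> sorted_wrt (<) ps"

abbreviation partition_pairs :: "real list \<Rightarrow> (real \<times> real) list" where
  "partition_pairs ps \<equiv> zip ps (tl ps)"

definition riemann_sum ::
    "nat \<Rightarrow> (real \<Rightarrow> functional) \<Rightarrow> ('a::euclidean_space \<Rightarrow> 'a) \<Rightarrow>
     (forest \<Rightarrow> real \<Rightarrow> 'a) \<Rightarrow> real list \<Rightarrow> 'a" where
  "riemann_sum N X \<phi> Y ps =
     (\<Sum>(u, v)\<leftarrow>partition_pairs ps. \<Sum>f\<in>forests (N - 1).
        increment N X u v (graft f) *\<^sub>R comp_deriv \<phi> Y f u)"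

definition has_rough_integral ::
    "nat \<Rightarrow> (real \<Rightarrow> functional) \<Rightarrow> ('a::euclidean_space \<Rightarrow> 'a) \<Rightarrow>
     (forest \<Rightarrow> real \<Rightarrow> 'a) \<Rightarrow> real \<Rightarrow> real \<Rightarrow> 'a \<Rightarrow> bool" where
  "has_rough_integral N X \<phi> Y s t I \<longleftrightarrow>
     (\<forall>\<epsilon>>0. \<exists>\<delta>>0. \<forall>ps. is_partition s t ps \<longrightarrow>
        (\<forall>(u, v)\<in>set (partition_pairs ps). v - u < \<delta>) \<longrightarrow>
        norm (riemann_sum N X \<phi> Y ps - I) < \<epsilon>)"

text \<open>The set \<open>U\<close> is the (open) domain of \<open>\<phi>\<close>: a solution must take its values
  there.\<close>

definition rde_solution ::
    "nat \<Rightarrow> real \<Rightarrow> (real \<Rightarrow> functional) \<Rightarrow> 'a set \<Rightarrow> ('a::euclidean_space \<Rightarrow> 'a) \<Rightarrow>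
     real set \<Rightarrow> (forest \<Rightarrow> real \<Rightarrow> 'a) \<Rightarrow> bool" where
  "rde_solution N \<gamma> X U \<phi> J Y \<longleftrightarrow>
     controlled_rough_path N \<gamma> X J Y \<and>
     (\<forall>t\<in>J. Y {#} t \<in> U) \<and>
     (\<forall>t\<in>J. has_rough_integral N X \<phi> Y 0 t (Y {#} t - Y {#} 0)) \<and>
     (\<forall>f\<in>forests (N - 2). \<forall>t\<in>J. Y (graft f) t = comp_deriv \<phi> Y f t) \<and>
     (\<forall>f\<in>forests (N - 1). size f \<ge> 2 \<longrightarrow> (\<forall>t\<in>J. Y f t = 0))"

definition explodes_in_finite_time ::
    "nat \<Rightarrow> real \<Rightarrow> (real \<Rightarrow> functional) \<Rightarrow> 'a set \<Rightarrow> ('a::euclidean_space \<Rightarrow> 'a) \<Rightarrow> 'a \<Rightarrow> bool" where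
  "explodes_in_finite_time N \<gamma> X U \<phi> y\<^sub>0 \<longleftrightarrow>
     (\<exists>\<xi>>0. \<exists>Y. rde_solution N \<gamma> X U \<phi> {0..<\<xi>} Y \<and> Y {#} 0 = y\<^sub>0 \<and>
        filterlim (\<lambda>t. norm (Y {#} t)) at_top (at_left \<xi>))"

definition Cb :: "nat \<Rightarrow> (real \<Rightarrow> real) set" where
  "Cb n = {f. (\<forall>j<n. \<forall>x. (deriv ^^ j) f differentiable at x) \<and>
              (\<forall>j\<le>n. continuous_on UNIV ((deriv ^^ j) f) \<and> bounded (range ((deriv ^^ j) f)))}"

end

theory Submission
  imports Defs "HOL-Real_Asymp.Real_Asymp"
begin

text \<open>The driving path moves along a single ladder \<open>L\<close> with \<open>N\<close> vertices.  Up to degree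
  \<open>N\<close> the coproduct of a forest contains \<open>L\<close> on the left only in the term \<open>L \<otimes> 1\<close>
  of \<open>L\<close> itself (\<open>tensor_pairing_primitive_path\<close>), so the increments are
  \<open>1 + (t - s) L\<close> (\<open>increment_primitive_path\<close>), and the remainder of a controlled path is
  the plain increment of its components (\<open>remainder_primitive_path\<close>).  The equation therefore is
  the ordinary differential equation \<open>y' = F y\<close> whose vector field \<open>F\<close> is the elementary
  differential of \<open>\<phi>\<close> for \<open>L\<close>, that is, the derivative of \<open>\<phi>\<close> applied
  \<open>N - 1\<close> times to \<open>\<phi>\<close>.

  On the axis \<open>e 1\<close>, at the point with coordinate \<open>x > 0\<close>, the field \<open>\<phi>\<close> is
  \<open>x powr \<beta>\<close> times \<open>e N\<close>, and for \<open>1 \<le> k < N\<close> its derivative takes \<open>e (k + 1)\<close> to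
  \<open>x powr \<beta>\<close> times \<open>e k\<close> (\<open>iterated_deriv_at_axis\<close>).  Hence \<open>F\<close> is
  \<open>x powr (N * \<beta>)\<close> times \<open>e 1\<close>: the axis is invariant, and the first coordinate solves
  \<open>x' = x powr (N * \<beta>)\<close>.  The exponent exceeds \<open>1\<close>, so \<open>x\<close> explodes at time
  \<open>1 / (N * \<beta> - 1)\<close>.

  Bounded as \<open>fe 0\<close> and \<open>fe 1\<close> are, \<open>\<phi>\<close> may grow sublinearly (\<open>\<beta> < 1\<close>) and the
  explosion still occurs, because each of the \<open>N\<close> vertices contributes a factor
  \<open>x powr \<beta>\<close>.  What remains is to check that the components prescribed by this picture, zero on
  all forests other than ladders, satisfy every compatibility condition.  This is
  \<open>comp_deriv_Y\<close>, which holds because the higher derivatives of \<open>\<phi>\<close> on the axis vanish in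
  all directions that occur.\<close>

section \<open>Ladders and the graded coproduct\<close>

definition ladder :: "nat \<Rightarrow> forest" where
  "ladder k = (graft ^^ k) {#}"

lemma ladder_simps [simp]: "ladder 0 = {#}" "ladder (Suc k) = graft (ladder k)"
  by (simp_all add: ladder_def)

lemma vertices_ladder [simp]: "vertices (ladder k) = k"
  by (induction k) simp_all

lemma graft_eq_iff [simp]: "graft f = graft g \<longleftrightarrow> f = g"
  by (simp add: graft_def)

lemma graft_neq_empty [simp]: "graft f \<noteq> {#}" "{#} \<noteq> graft f"
  by (simp_all add: graft_def)

lemma vertices_eq_0_iff [simp]: "vertices f = 0 \<longleftrightarrow> f = {#}"
  using size_le_vertices[of f] by auto

lemma size_ladder_le: "size (ladder k) \<le> 1"
  by (cases k) (simp_all add: graft_def)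

lemma lookup_id_tensor_graft:
  "Poly_Mapping.lookup (id_tensor_graft h) (a, graft b) = Poly_Mapping.lookup h (a, b)"
proof -
  have "Poly_Mapping.lookup (id_tensor_graft h) (a, graft b) =
    (\<Sum>p\<in>Poly_Mapping.keys h. if p = (a, b) then Poly_Mapping.lookup h (a, b) else 0)"
    unfolding id_tensor_graft_def lookup_sum
    by (intro sum.cong) (auto simp: lookup_single when_def split: prod.splits)
  then show ?thesis
    by (simp add: in_keys_iff)
qed

lemma keys_sum_single_subset:
  assumes "finite A"
  shows "Poly_Mapping.keys (\<Sum>p\<in>A. Poly_Mapping.single (k p) (c p)) \<subseteq> k ` A"
  using assms
proof (induction A rule: finite_induct)
  case (insert p A)
  then show ?case
    using keys_add[of "Poly_Mapping.single (k p) (c p)" "\<Sum>p\<in>A. Poly_Mapping.single (k p) (c p)"]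
    by (auto split: if_splits)
qed simp

lemma keys_id_tensor_graft:
  "Poly_Mapping.keys (id_tensor_graft h) \<subseteq> (\<lambda>(a, b). (a, graft b)) ` Poly_Mapping.keys h"
  unfolding id_tensor_graft_def case_prod_unfold
  by (rule order_trans[OF keys_sum_single_subset]) auto

text \<open>Forests are generated from the empty one by grafting and multiplication, which are exactly the
  operations along which the coproduct is computed.\<close>

lemma forest_induct [case_names empty graft mult]:
  assumes "P {#}" and "\<And>f. P f \<Longrightarrow> P (graft f)" and "\<And>f g. P f \<Longrightarrow> P g \<Longrightarrow> P (f + g)"
  shows "P f"
proof (induction "vertices f" arbitrary: f rule: less_induct)
  case less
  show ?case
  proof (cases f)
    case empty
    then show ?thesis using assms(1) by simp
  next
    case (add \<tau> g)
    obtain h where \<tau>: "\<tau> = Node h" by (cases \<tau>)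
    have "f = graft h + g" using add \<tau> by (simp add: graft_def)
    moreover have "P h" by (rule less) (simp add: add \<tau>)
    moreover have "P g" by (rule less) (simp add: add \<tau>)
    ultimately show ?thesis using assms(3)[OF assms(2)] by simp
  qed
qed

lemma coproduct_graded:
  "(a, b) \<in> Poly_Mapping.keys (coproduct f) \<Longrightarrow> vertices a + vertices b = vertices f"
proof (induction f arbitrary: a b rule: forest_induct)
  case empty
  then have "(a, b) = ({#}, {#})"
    unfolding coproduct_empty keys_single by simp
  then show ?case by simp
next
  case (graft f)
  then consider "(a, b) \<in> Poly_Mapping.keys (Poly_Mapping.single (Defs.graft f, {#}) (1::real))"
    | "(a, b) \<in> Poly_Mapping.keys (id_tensor_graft (coproduct f))"
    unfolding coproduct_graft by (meson UnE keys_add subsetD)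
  then show ?case
  proof cases
    case 1
    then show ?thesis by simp
  next
    case 2
    then obtain c where "b = Defs.graft c" "(a, c) \<in> Poly_Mapping.keys (coproduct f)"
      using subsetD[OF keys_id_tensor_graft 2] by auto
    then show ?thesis using graft.IH[of a c] by simp
  qed
next
  case (mult f g)
  then obtain p q where pq: "(a, b) = p + q" "p \<in> Poly_Mapping.keys (coproduct f)"
    "q \<in> Poly_Mapping.keys (coproduct g)"
    using subsetD[OF keys_mult, of "(a, b)" "coproduct f" "coproduct g"]
    unfolding coproduct_mult by auto
  obtain p1 p2 q1 q2 where split: "p = (p1, p2)" "q = (q1, q2)" by (meson surj_pair)
  then have "vertices p1 + vertices p2 = vertices f" "vertices q1 + vertices q2 = vertices g"
    using pq mult.IH by auto
  then show ?case using pq(1) split by simp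
qed

text \<open>If \<open>K\<close> is a face of the monoid, that is, a sum lies in \<open>K\<close> only if both
  summands do, then the coefficients of a product at the keys in \<open>K\<close> depend only on the
  coefficients of the factors there.  The pairs \<open>({#}, b)\<close> and the pairs \<open>(a, {#})\<close> are
  such faces, and these are the two marginals of the coproduct needed below.\<close>

lemma unit_key_mult:
  fixes S T :: "('a::monoid_add) \<Rightarrow>\<^sub>0 real"
  assumes "\<And>p. p \<in> K \<Longrightarrow> Poly_Mapping.lookup S p = (1 when p = u)"
    and "\<And>p. p \<in> K \<Longrightarrow> Poly_Mapping.lookup T p = (1 when p = v)"
    and u: "u \<in> K" and v: "v \<in> K"
    and K: "\<And>p q. p + q \<in> K \<longleftrightarrow> p \<in> K \<and> q \<in> K"
    and "p \<in> K"
  shows "Poly_Mapping.lookup (S * T) p = (1 when p = u + v)"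
proof -
  define S' T' where "S' = S - Poly_Mapping.single u 1" and "T' = T - Poly_Mapping.single v 1"
  have *: "Poly_Mapping.keys S' \<inter> K = {}" "Poly_Mapping.keys T' \<inter> K = {}"
    using assms(1,2) by (auto simp: S'_def T'_def in_keys_iff lookup_minus lookup_single when_def split: if_splits)
  have "S * T = Poly_Mapping.single (u + v) 1 + (Poly_Mapping.single u 1 * T' + S' * T)"
    by (simp add: S'_def T'_def algebra_simps mult_single)
  moreover have "p \<notin> Poly_Mapping.keys (Poly_Mapping.single u 1 * T')"
    using keys_mult[of "Poly_Mapping.single u 1" T'] * \<open>p \<in> K\<close> K by fastforce
  moreover have "p \<notin> Poly_Mapping.keys (S' * T)"
    using keys_mult[of S' T] * \<open>p \<in> K\<close> K by fastforce
  ultimately show ?thesis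
    by (auto simp: lookup_add lookup_single in_keys_iff when_def)
qed

lemma lookup_coproduct_empty_left:
  "Poly_Mapping.lookup (coproduct f) ({#}, b) = (1 when b = f)"
proof (induction f arbitrary: b rule: forest_induct)
  case empty
  then show ?case by (auto simp: coproduct_empty lookup_single when_def)
next
  case (graft f)
  show ?case
  proof (cases "b \<in> range Defs.graft")
    case True
    then show ?thesis
      by (auto simp: coproduct_graft lookup_add lookup_single lookup_id_tensor_graft graft.IH when_def)
  next
    case False
    then have "({#}, b) \<notin> Poly_Mapping.keys (id_tensor_graft (coproduct f))"
      using keys_id_tensor_graft[of "coproduct f"] by auto
    then show ?thesis
      using False by (auto simp: coproduct_graft lookup_add lookup_single in_keys_iff when_def)
  qed
next
  case (mult f g)
  have "Poly_Mapping.lookup (coproduct f * coproduct g) ({#}, b) = (1 when ({#} :: forest, b) = ({#}, f) + ({#}, g))"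
    by (rule unit_key_mult[where K = "{p :: forest \<times> forest. fst p = {#}}"])
      (use mult.IH in \<open>auto simp: when_def split: if_splits\<close>)
  then show ?case by (simp add: coproduct_mult)
qed

lemma lookup_coproduct_empty_right:
  "Poly_Mapping.lookup (coproduct f) (a, {#}) = (1 when a = f)"
proof (induction f arbitrary: a rule: forest_induct)
  case empty
  then show ?case by (auto simp: coproduct_empty lookup_single when_def)
next
  case (graft f)
  have "(a, {#}) \<notin> Poly_Mapping.keys (id_tensor_graft (coproduct f))"
    using keys_id_tensor_graft[of "coproduct f"] by auto
  then show ?case
    by (auto simp: coproduct_graft lookup_add lookup_single in_keys_iff when_def)
next
  case (mult f g)
  have "Poly_Mapping.lookup (coproduct f * coproduct g) (a, {#}) = (1 when (a, {#} :: forest) = (f, {#}) + (g, {#}))"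
    by (rule unit_key_mult[where K = "{p :: forest \<times> forest. snd p = {#}}"])
      (use mult.IH in \<open>auto simp: when_def split: if_splits\<close>)
  then show ?case by (simp add: coproduct_mult)
qed

section \<open>The rough path of a single tree\<close>

text \<open>The name refers to the dual algebra: truncated at the degree of the tree \<open>L\<close>, the functional
  \<open>dual L\<close> is primitive, and \<open>primitive_path L t\<close> is the exponential of
  \<open>t\<close> times it, all higher powers being cut off.\<close>

definition primitive_path :: "forest \<Rightarrow> real \<Rightarrow> functional" where
  "primitive_path L t = (\<lambda>h. dual {#} h + t * dual L h)"

text \<open>By the grading, a forest with at most as many vertices as \<open>L\<close> splits off a left factor
  \<open>L\<close> only as \<open>L \<otimes> 1\<close>, so the pairing sees nothing of the coproduct beyond its two
  marginals.  Every computation with increments and remainders rests on this.\<close>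

lemma tensor_pairing_primitive_path:
  assumes "L \<noteq> {#}" and "vertices f \<le> vertices L"
  shows "tensor_pairing (primitive_path L t) y (coproduct f) = y f + t * (y {#} when f = L)"
proof -
  let ?K = "Poly_Mapping.keys (coproduct f)"
  have "tensor_pairing (primitive_path L t) y (coproduct f) =
    (\<Sum>p\<in>?K. (if p = ({#}, f) then y f else 0) + (if p = (L, {#}) then t * (y {#} when f = L) else 0))"
    unfolding tensor_pairing_def
  proof (intro sum.cong refl, clarify)
    fix a b assume ab: "(a, b) \<in> ?K"
    consider "a = {#}" | "a = L" | "a \<noteq> {#}" "a \<noteq> L" by blast
    then show "Poly_Mapping.lookup (coproduct f) (a, b) * (primitive_path L t a * y b) =
      (if (a, b) = ({#}, f) then y f else 0) + (if (a, b) = (L, {#}) then t * (y {#} when f = L) else 0)"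
    proof cases
      case 1
      then show ?thesis
        using assms(1) by (simp add: primitive_path_def dual_def lookup_coproduct_empty_left when_def)
    next
      case 2
      with coproduct_graded[OF ab] assms(2) have "b = {#}"
        by (metis add_diff_cancel_left' diff_is_0_eq vertices_eq_0_iff)
      then show ?thesis
        using 2 assms(1) by (simp add: primitive_path_def dual_def lookup_coproduct_empty_right when_def)
    next
      case 3
      then show ?thesis by (simp add: primitive_path_def dual_def)
    qed
  qed
  also have "\<dots> = y f + t * (y {#} when f = L)"
    by (auto simp: sum.distrib in_keys_iff lookup_coproduct_empty_left lookup_coproduct_empty_right when_def)
  finally show ?thesis .
qed

text \<open>The multiplicative extension of the values on single trees is a character.  It is nonzero only
  on powers of \<open>graft f\<close>, and the truncation removes the powers from the square on.\<close>

lemma primitive_path_in_char_group: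
  assumes "vertices (graft f) = N"
  shows "primitive_path (graft f) t \<in> carrier (char_group N)"
proof -
  define c where "c \<tau> = (t when \<tau> = Node f)" for \<tau>
  define x :: functional where "x h = (\<Prod>\<tau>\<in>#h. c \<tau>)" for h
  have "is_character x" by (simp add: is_character_def x_def)
  moreover have "truncate N x = primitive_path (graft f) t"
  proof
    fix h
    show "truncate N x h = primitive_path (graft f) t h"
    proof (cases "set_mset h \<subseteq> {Node f}")
      case True
      obtain n where h: "h = replicate_mset n (Node f)"
        by (rule that[OF set_mset_subset_singletonD[OF True]])
      have v: "vertices h = n * N"
        unfolding h by (induction n) (use assms in simp_all)
      have "N > 0" using assms by auto
      consider "n = 0" | "n = 1" | "n \<ge> 2" by linarith
      then show ?thesis
      proof cases
        case 3
        then have "2 * N \<le> vertices h" unfolding v by (rule mult_le_mono1)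
        then have "h \<notin> forests N" using \<open>N > 0\<close> by (simp add: forests_def)
        moreover have "size h = n" by (simp add: h)
        then have "h \<noteq> {#Node f#}" "h \<noteq> {#}"
          using 3 by auto
        ultimately show ?thesis by (simp add: truncate_def primitive_path_def dual_def graft_def)
      qed (use v in \<open>auto simp: truncate_def forests_def primitive_path_def dual_def h graft_def x_def c_def\<close>)
    next
      case False
      then obtain \<tau> where "\<tau> \<in># h" "\<tau> \<noteq> Node f" by auto
      then obtain g where "h = add_mset \<tau> g" by (meson multi_member_split)
      then have "x h = 0" using \<open>\<tau> \<noteq> Node f\<close> by (simp add: x_def c_def)
      moreover have "h \<noteq> {#}" "h \<noteq> graft f" using False by (auto simp: graft_def)
      ultimately show ?thesis by (simp add: truncate_def primitive_path_def dual_def)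
    qed
  qed
  ultimately show ?thesis by (force simp: char_group_def)
qed

lemma char_group_carrierD:
  assumes "y \<in> carrier (char_group N)"
  shows "y {#} = 1" "h \<notin> forests N \<Longrightarrow> y h = 0"
proof -
  obtain x where "is_character x" "y = truncate N x"
    using assms by (auto simp: char_group_def)
  then show "y {#} = 1" "h \<notin> forests N \<Longrightarrow> y h = 0"
    by (simp_all add: truncate_def is_character_def forests_def)
qed

lemma primitive_path_mult:
  assumes L: "L = graft f" "vertices L = N" and y: "y \<in> carrier (char_group N)"
  shows "primitive_path L t \<otimes>\<^bsub>char_group N\<^esub> y = (\<lambda>h. y h + t * dual L h)"
proof
  fix h
  show "(primitive_path L t \<otimes>\<^bsub>char_group N\<^esub> y) h = y h + t * dual L h"
  proof (cases "h \<in> forests N")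
    case True
    then show ?thesis
      using tensor_pairing_primitive_path[of L h t y] L char_group_carrierD[OF y]
      by (simp add: char_group_def truncate_def star_def forests_def dual_def when_def)
  next
    case False
    then show ?thesis
      using char_group_carrierD(2)[OF y False] L
      by (auto simp: char_group_def truncate_def dual_def forests_def)
  qed
qed

text \<open>Left multiplication by \<open>primitive_path L s\<close> only shifts the value at \<open>L\<close>.  This
  determines the inverse, and it makes \<open>primitive_path L\<close> a one-parameter group.\<close>

lemma increment_primitive_path:
  assumes L: "L = graft f" "vertices L = N"
  shows "increment N (primitive_path L) s t = primitive_path L (t - s)"
proof -
  let ?G = "char_group N"
  have mem: "primitive_path L r \<in> carrier ?G" for r
    using primitive_path_in_char_group[of f N r] L by simp
  have mult: "primitive_path L r \<otimes>\<^bsub>?G\<^esub> primitive_path L r' = primitive_path L (r + r')" for r r'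
    using primitive_path_mult[OF L mem] by (auto simp: primitive_path_def algebra_simps)
  have one: "\<one>\<^bsub>?G\<^esub> = primitive_path L 0"
    by (simp add: char_group_def primitive_path_def)
  have "inv\<^bsub>?G\<^esub> primitive_path L s = primitive_path L (- s)"
    unfolding m_inv_def
  proof (rule the_equality)
    fix y
    assume "y \<in> carrier ?G \<and> primitive_path L s \<otimes>\<^bsub>?G\<^esub> y = \<one>\<^bsub>?G\<^esub> \<and> y \<otimes>\<^bsub>?G\<^esub> primitive_path L s = \<one>\<^bsub>?G\<^esub>"
    then have "(\<lambda>h. y h + s * dual L h) = primitive_path L 0"
      using primitive_path_mult[OF L] one by metis
    then have "y h + s * dual L h = primitive_path L 0 h" for h by metis
    then show "y = primitive_path L (- s)"
      by (auto simp: primitive_path_def algebra_simps)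
  qed (use mem mult one in simp)
  then show ?thesis
    by (simp add: increment_def mult)
qed

lemma divide_powr_le:
  fixes d D p :: real
  assumes "0 < d" "d \<le> D" "p \<le> 1"
  shows "d / d powr p \<le> D powr (1 - p)"
proof -
  have "d / d powr p = d powr (1 - p)" using powr_diff[of d 1 p] assms(1) by simp
  also have "\<dots> \<le> D powr (1 - p)" using assms by (intro powr_mono2) auto
  finally show ?thesis .
qed

lemma branched_rough_path_primitive_path:
  assumes L: "L = graft f" "vertices L = N" and \<gamma>: "\<gamma> * real N \<le> 1"
  shows "branched_rough_path N \<gamma> T (primitive_path L)"
  unfolding branched_rough_path_def
proof (intro conjI ballI)
  show "primitive_path L t \<in> carrier (char_group N)" for t
    using primitive_path_in_char_group[of f N t] L by simp
next
  fix h assume "h \<in> forests N"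
  show "\<exists>C. \<forall>s t. 0 \<le> s \<longrightarrow> s < t \<longrightarrow> t \<le> T \<longrightarrow>
    \<bar>increment N (primitive_path L) s t h\<bar> / \<bar>t - s\<bar> powr (\<gamma> * real (vertices h)) \<le> C"
  proof (rule exI[of _ "1 + T powr (1 - \<gamma> * real N)"], intro allI impI)
    fix s t :: real assume st: "0 \<le> s" "s < t" "t \<le> T"
    have "(t - s) / (t - s) powr (\<gamma> * real N) \<le> T powr (1 - \<gamma> * real N)"
      using st \<gamma> by (intro divide_powr_le) auto
    moreover have "L \<noteq> {#}" using L(1) by simp
    ultimately show "\<bar>increment N (primitive_path L) s t h\<bar> / \<bar>t - s\<bar> powr (\<gamma> * real (vertices h)) \<le>
      1 + T powr (1 - \<gamma> * real N)"
      using st unfolding increment_primitive_path[OF L]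
      by (auto simp: primitive_path_def dual_def L(2))
  qed
qed

text \<open>Controlled paths have components of fewer than \<open>N\<close> vertices only.  These do not see the
  driving tree, so the remainder is an ordinary increment and being controlled is mere
  Hoelder continuity of the components.\<close>

lemma remainder_primitive_path:
  assumes L: "L = graft f" "vertices L = N" and h: "h \<in> forests (N - 1)"
  shows "remainder N (primitive_path L) Y h s t = Y h t - Y h s"
proof -
  have "N > 0" using L by auto
  have "tensor_pairing (primitive_path L (t - s)) (dual h) (coproduct g) *\<^sub>R Y g s =
    (if g = h then Y h s else 0)" if "g \<in> forests (N - 1)" for g
  proof -
    have "vertices g < vertices L" using that L(2) \<open>N > 0\<close> by (auto simp: forests_def)
    moreover from this have "g \<noteq> L" by auto
    moreover have "L \<noteq> {#}" using L(1) by simp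
    ultimately show ?thesis
      using tensor_pairing_primitive_path[of L g "t - s" "dual h"]
      by (auto simp: dual_def when_def)
  qed
  then show ?thesis
    unfolding remainder_def increment_primitive_path[OF L]
    using h by (simp add: finite_forests)
qed

section \<open>Iterated derivatives of the vector field\<close>

text \<open>Each component of the vector field is a power of the coordinate \<open>a\<close> times a function of one
  further coordinate.  Along directions with vanishing \<open>a\<close>-coordinate the first factor is
  never differentiated, so no mixed terms arise.  The induction needs the formula at all points of
  the open half-space, although it is used at a single axis only.\<close>

lemma iterated_deriv_powr_mult:
  fixes \<phi> :: "real ^ 'n::finite \<Rightarrow> real ^ 'n" and h :: "'n \<Rightarrow> real \<Rightarrow> real"
  assumes \<phi>: "\<And>x i. x $ a > 0 \<Longrightarrow> \<phi> x $ i = (x $ a) powr \<beta> * h i (x $ \<sigma> i)"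
    and h: "\<And>i j x. j < m \<Longrightarrow> (deriv ^^ j) (h i) differentiable at x"
    and vs: "length vs \<le> m" "\<And>v. v \<in> set vs \<Longrightarrow> v $ a = 0"
    and y: "y $ a > 0"
  shows "iterated_deriv \<phi> vs y $ i =
    (y $ a) powr \<beta> * (deriv ^^ length vs) (h i) (y $ \<sigma> i) * (\<Prod>v\<leftarrow>vs. v $ \<sigma> i)"
  using vs y
proof (induction vs arbitrary: y i)
  case Nil
  then show ?case by (simp add: \<phi>)
next
  case (Cons v vs)
  define n where "n = length vs"
  have n: "n < m" using Cons.prems by (simp add: n_def)
  define c where "c i = (\<Prod>v\<leftarrow>vs. v $ \<sigma> i)" for i
  define G :: "real ^ 'n \<Rightarrow> real ^ 'n"
    where "G x = (\<chi> i. (x $ a) powr \<beta> * (deriv ^^ n) (h i) (x $ \<sigma> i) * c i)" for x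
  define G' :: "real ^ 'n \<Rightarrow> real ^ 'n"
    where "G' v = (\<chi> i. (\<beta> * (y $ a) powr (\<beta> - 1) * v $ a * (deriv ^^ n) (h i) (y $ \<sigma> i) +
      (y $ a) powr \<beta> * ((deriv ^^ Suc n) (h i) (y $ \<sigma> i) * v $ \<sigma> i)) * c i)" for v
  have D1: "((\<lambda>x. (x $ a) powr \<beta>) has_derivative (\<lambda>v. \<beta> * (y $ a) powr (\<beta> - 1) * v $ a)) (at y)"
    using DERIV_compose_FDERIV[where f = "\<lambda>z. z powr \<beta>" and g = "\<lambda>x. x $ a" and x = y and s = UNIV,
        OF has_real_derivative_powr[OF Cons.prems(3)]
          bounded_linear_imp_has_derivative[OF bounded_linear_vec_nth]]
    by (simp add: mult_ac)
  have D2: "((\<lambda>x. (deriv ^^ n) (h i) (x $ \<sigma> i)) has_derivative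
      (\<lambda>v. (deriv ^^ Suc n) (h i) (y $ \<sigma> i) * v $ \<sigma> i)) (at y)" for i
  proof -
    have "((deriv ^^ n) (h i) has_real_derivative (deriv ^^ Suc n) (h i) (y $ \<sigma> i)) (at (y $ \<sigma> i))"
      using h[OF n, of i "y $ \<sigma> i"]
      by (simp add: DERIV_deriv_iff_real_differentiable)
    from DERIV_compose_FDERIV[where g = "\<lambda>x. x $ \<sigma> i" and x = y and s = UNIV, OF this
        bounded_linear_imp_has_derivative[OF bounded_linear_vec_nth]]
    show ?thesis
      by (simp add: mult_ac)
  qed
  have "(G has_derivative G') (at y)"
    unfolding has_derivative_componentwise_within[of G]
  proof
    fix b :: "real ^ 'n" assume "b \<in> Basis"
    then obtain i where b: "b = axis i 1" by (auto simp: Basis_vec_def)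
    have "((\<lambda>x. (x $ a) powr \<beta> * (deriv ^^ n) (h i) (x $ \<sigma> i) * c i) has_derivative
      (\<lambda>v. G' v $ i)) (at y)"
      by (rule has_derivative_eq_rhs[OF has_derivative_mult_left[OF has_derivative_mult[OF D1 D2[of i]]]])
        (simp add: G'_def algebra_simps)
    then show "((\<lambda>x. G x \<bullet> b) has_derivative (\<lambda>v. G' v \<bullet> b)) (at y)"
      by (simp add: b G_def inner_axis)
  qed
  moreover have "G x = iterated_deriv \<phi> vs x" if "x $ a > 0" for x
    using that Cons.prems by (simp add: vec_eq_iff G_def n_def c_def Cons.IH)
  \<comment> \<open>the Frechet derivative is insensitive to the values outside the open half-space\<close>
  moreover have "open {x :: real ^ 'n. x $ a > 0}"
    by (intro open_Collect_less continuous_intros)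
  ultimately have "(iterated_deriv \<phi> vs has_derivative G') (at y)"
    using Cons.prems(3) by (auto intro: has_derivative_transform_within_open)
  then have "frechet_derivative (iterated_deriv \<phi> vs) (at y) = G'"
    by (rule frechet_derivative_at[symmetric])
  then show ?case
    using Cons.prems(2) by (simp add: G'_def n_def c_def)
qed

section \<open>Left Riemann sums\<close>

lemma partition_subset_interval:
  assumes "is_partition a b ps"
  shows "set ps \<subseteq> {a..b}"
proof
  fix x assume x: "x \<in> set ps"
  have "hd ps \<le> x"
    using assms x by (cases ps) (auto simp: is_partition_def)
  moreover have "x \<le> last ps"
    using assms x by (cases ps rule: rev_cases) (auto simp: is_partition_def sorted_wrt_append)
  ultimately show "x \<in> {a..b}" using assms by (simp add: is_partition_def)
qed

text \<open>The local errors add up to an error proportional to the total length, whatever the number of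
  partition points.\<close>

lemma partition_sum_close:
  fixes F g :: "real \<Rightarrow> real"
  assumes step: "\<And>u v. a \<le> u \<Longrightarrow> u < v \<Longrightarrow> v \<le> b \<Longrightarrow> v - u < \<delta> \<Longrightarrow>
      \<bar>(v - u) * g u - (F v - F u)\<bar> \<le> (v - u) * \<epsilon>"
    and ps: "ps \<noteq> []" "sorted_wrt (<) ps" "set ps \<subseteq> {a..b}"
      "\<forall>(u, v)\<in>set (partition_pairs ps). v - u < \<delta>"
  shows "\<bar>(\<Sum>(u, v)\<leftarrow>partition_pairs ps. (v - u) * g u) - (F (last ps) - F (hd ps))\<bar>
    \<le> (last ps - hd ps) * \<epsilon>"
  using ps
proof (induction ps)
  case (Cons u ps)
  show ?case
  proof (cases ps)
    case (Cons v qs)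
    note ps = this
    have 1: "\<bar>(\<Sum>(u, v)\<leftarrow>partition_pairs ps. (v - u) * g u) - (F (last ps) - F (hd ps))\<bar>
      \<le> (last ps - hd ps) * \<epsilon>"
      using Cons.prems ps by (intro Cons.IH) auto
    have 2: "\<bar>(v - u) * g u - (F v - F u)\<bar> \<le> (v - u) * \<epsilon>"
      using Cons.prems ps by (intro step) auto
    have "\<bar>((v - u) * g u + (\<Sum>(u, v)\<leftarrow>partition_pairs ps. (v - u) * g u)) - (F (last ps) - F u)\<bar>
      \<le> (last ps - u) * \<epsilon>"
      using 1 2 ps by (simp add: algebra_simps)
    then show ?thesis using ps by simp
  qed simp
qed simp

lemma left_riemann_sums:
  fixes F g :: "real \<Rightarrow> real"
  assumes F: "\<And>u. u \<in> {a..b} \<Longrightarrow> (F has_real_derivative g u) (at u)"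
    and g: "continuous_on {a..b} g" and "\<epsilon> > 0"
  obtains \<delta> where "\<delta> > 0"
    and "\<And>ps. is_partition a b ps \<Longrightarrow> \<forall>(u, v)\<in>set (partition_pairs ps). v - u < \<delta> \<Longrightarrow>
      \<bar>(\<Sum>(u, v)\<leftarrow>partition_pairs ps. (v - u) * g u) - (F b - F a)\<bar> < \<epsilon>"
proof -
  define \<epsilon>' where "\<epsilon>' = \<epsilon> / (\<bar>b - a\<bar> + 1)"
  have "\<epsilon>' > 0" using \<open>\<epsilon> > 0\<close> by (simp add: \<epsilon>'_def)
  obtain \<delta> where \<delta>: "\<delta> > 0"
    "\<And>u v. u \<in> {a..b} \<Longrightarrow> v \<in> {a..b} \<Longrightarrow> dist v u < \<delta> \<Longrightarrow> dist (g v) (g u) < \<epsilon>'"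
    using compact_uniformly_continuous[OF g] \<open>\<epsilon>' > 0\<close>
    unfolding uniformly_continuous_on_def by (metis compact_Icc)
  have step: "\<bar>(v - u) * g u - (F v - F u)\<bar> \<le> (v - u) * \<epsilon>'"
    if uv: "a \<le> u" "u < v" "v \<le> b" "v - u < \<delta>" for u v
  proof -
    obtain z where z: "u < z" "z < v" "F v - F u = (v - u) * g z"
      using MVT2[of u v F g] F uv by auto
    have "\<bar>g u - g z\<bar> \<le> \<epsilon>'"
      using \<delta>(2)[of u z] z uv by (auto simp: dist_real_def)
    moreover have "(v - u) * g u - (F v - F u) = (v - u) * (g u - g z)"
      using z by (simp add: algebra_simps)
    ultimately show ?thesis
      using uv by (simp add: abs_mult)
  qed
  show thesis
  proof (rule that[OF \<delta>(1)])
    fix ps assume ps: "is_partition a b ps" "\<forall>(u, v)\<in>set (partition_pairs ps). v - u < \<delta>"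
    then have ne: "ps \<noteq> []" "sorted_wrt (<) ps" "hd ps = a" "last ps = b"
      by (auto simp: is_partition_def)
    note sub = partition_subset_interval[OF ps(1)]
    have "\<bar>(\<Sum>(u, v)\<leftarrow>partition_pairs ps. (v - u) * g u) - (F b - F a)\<bar> \<le> (b - a) * \<epsilon>'"
      using partition_sum_close[of a b \<delta> g F \<epsilon>', OF step ne(1,2) sub ps(2)] ne by simp
    also have "\<dots> < \<epsilon>"
    proof -
      have "(b - a) * \<epsilon> < \<epsilon> * (\<bar>b - a\<bar> + 1)"
        using \<open>\<epsilon> > 0\<close> by (smt (verit) mult_less_cancel_left mult.commute)
      then show ?thesis
        by (simp add: \<epsilon>'_def pos_divide_less_eq add_nonneg_pos)
    qed
    finally show "\<bar>(\<Sum>(u, v)\<leftarrow>partition_pairs ps. (v - u) * g u) - (F b - F a)\<bar> < \<epsilon>" .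
  qed
qed

section \<open>The exploding profile\<close>

text \<open>The solution of \<open>x' = x powr (1 + 1 / \<xi>)\<close> with \<open>x 0 = 1\<close>; the parameter is chosen to be
  the explosion time.\<close>

definition profile :: "real \<Rightarrow> real \<Rightarrow> real" where
  "profile \<xi> t = (1 - t / \<xi>) powr (- \<xi>)"

lemma
  assumes "\<xi> > 0"
  shows profile_0: "profile \<xi> 0 = 1"
    and profile_pos: "t < \<xi> \<Longrightarrow> profile \<xi> t > 0"
    and profile_deriv:
      "t < \<xi> \<Longrightarrow> (profile \<xi> has_real_derivative profile \<xi> t powr (1 + 1 / \<xi>)) (at t)"
    and profile_explodes: "filterlim (profile \<xi>) at_top (at_left \<xi>)"
proof -
  show "profile \<xi> 0 = 1" by (simp add: profile_def)
  show "t < \<xi> \<Longrightarrow> profile \<xi> t > 0" using assms by (simp add: profile_def)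
  show "(profile \<xi> has_real_derivative profile \<xi> t powr (1 + 1 / \<xi>)) (at t)" if "t < \<xi>"
  proof -
    have "1 - t / \<xi> > 0" using that assms by simp
    moreover have e: "- \<xi> * (1 + 1 / \<xi>) = - \<xi> - 1" using assms by (simp add: field_simps)
    ultimately show ?thesis
      unfolding profile_def powr_powr e using assms
      by (auto intro!: derivative_eq_intros)
  qed
  have 1: "filterlim (\<lambda>t. 1 - t / \<xi>) (at_right 0) (at_left \<xi>)"
    unfolding filterlim_at
  proof
    have "((\<lambda>t. 1 - t / \<xi>) \<longlongrightarrow> 1 - \<xi> / \<xi>) (at_left \<xi>)"
      using assms by (intro tendsto_intros) auto
    then show "((\<lambda>t. 1 - t / \<xi>) \<longlongrightarrow> 0) (at_left \<xi>)" using assms by simp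
    have "\<forall>\<^sub>F t in at_left \<xi>. t < \<xi>"
      by (simp add: eventually_at_filter)
    then show "\<forall>\<^sub>F x in at_left \<xi>. 1 - x / \<xi> \<in> {0<..} \<and> 1 - x / \<xi> \<noteq> 0"
      by eventually_elim (use assms in auto)
  qed
  have 2: "filterlim (\<lambda>x. x powr (- \<xi>)) at_top (at_right (0::real))"
    using assms by real_asymp
  show "filterlim (profile \<xi>) at_top (at_left \<xi>)"
    unfolding profile_def by (rule filterlim_compose[OF 2 1])
qed

lemma lipschitz_powr_profile:
  assumes "\<xi> > 0" "b < \<xi>"
  obtains K where "K \<ge> 0" "\<And>s t. a \<le> s \<Longrightarrow> s < t \<Longrightarrow> t \<le> b \<Longrightarrow>
     \<bar>profile \<xi> t powr p - profile \<xi> s powr p\<bar> \<le> K * (t - s)"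
proof -
  define g where "g t = p * profile \<xi> t powr (p - 1) * profile \<xi> t powr (1 + 1 / \<xi>)" for t
  have D: "((\<lambda>t. profile \<xi> t powr p) has_real_derivative g t) (at t)" if "t < \<xi>" for t
    using profile_pos[OF assms(1) that] profile_deriv[OF assms(1) that] unfolding g_def
    by (auto intro!: derivative_eq_intros)
  have "isCont (profile \<xi>) t" if "t < \<xi>" for t
    using profile_deriv[OF assms(1) that] DERIV_isCont by blast
  then have "continuous_on {a..b} (profile \<xi>)"
    using assms by (intro continuous_at_imp_continuous_on) auto
  then have "continuous_on {a..b} g"
    unfolding g_def using assms profile_pos[OF assms(1)]
    by (intro continuous_intros) (auto simp: less_imp_neq[symmetric])
  then have "bounded (g ` {a..b})"
    by (intro compact_imp_bounded compact_continuous_image) auto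
  then obtain K where K: "K > 0" "\<And>x. x \<in> {a..b} \<Longrightarrow> \<bar>g x\<bar> \<le> K"
    unfolding bounded_pos by auto
  show thesis
  proof (rule that)
    show "K \<ge> 0" using K by simp
    fix s t assume st: "a \<le> s" "s < t" "t \<le> b"
    obtain z where z: "s < z" "z < t" "profile \<xi> t powr p - profile \<xi> s powr p = (t - s) * g z"
      using MVT2[of s t "\<lambda>t. profile \<xi> t powr p" g] D st assms by auto
    have "\<bar>g z\<bar> \<le> K" using K z st by auto
    then show "\<bar>profile \<xi> t powr p - profile \<xi> s powr p\<bar> \<le> K * (t - s)"
      using st unfolding z(3) abs_mult by (simp add: mult.commute mult_right_mono)
  qed
qed

section \<open>The solution and its explosion\<close>

locale ladder_rde =
  fixes N :: nat and \<beta> :: real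
    and fe :: "nat \<Rightarrow> real \<Rightarrow> real"
    and e :: "nat \<Rightarrow> 'n::finite"
    and \<phi> :: "real ^ 'n \<Rightarrow> real ^ 'n"
  assumes N: "N \<ge> 2"
    and \<beta>: "\<beta> > 1 / real N"
    and coords: "bij_betw e {1..N} (UNIV :: 'n set)"
    and fe: "\<And>k. k \<in> {0, 1} \<Longrightarrow> fe k \<in> Cb (N - 1)"
            "\<And>k. k \<in> {0, 1} \<Longrightarrow> (deriv ^^ k) (fe k) 0 = 1"
            "\<And>k j. k \<in> {0, 1} \<Longrightarrow> j \<in> {0..N - 1} - {k} \<Longrightarrow> (deriv ^^ j) (fe k) 0 = 0"
    and \<phi>: "\<And>x k. x $ e 1 > 0 \<Longrightarrow> k \<in> {1..<N} \<Longrightarrow>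
               \<phi> x $ e k = (x $ e 1) powr \<beta> * fe 1 (x $ e (k + 1))"
           "\<And>x. x $ e 1 > 0 \<Longrightarrow> \<phi> x $ e N = (x $ e 1) powr \<beta> * fe 0 (x $ e N)"
begin

definition \<xi> :: real where "\<xi> = 1 / (real N * \<beta> - 1)"

lemma \<xi>_pos: "\<xi> > 0" and \<xi>_exponent: "1 + 1 / \<xi> = real N * \<beta>"
proof -
  have "real N * (1 / real N) < real N * \<beta>"
    using N \<beta> by (intro mult_strict_left_mono) auto
  then have "real N * \<beta> - 1 > 0" using N by simp
  then show "\<xi> > 0" "1 + 1 / \<xi> = real N * \<beta>"
    by (simp_all add: \<xi>_def)
qed

lemma e_eq_iff: "j \<in> {1..N} \<Longrightarrow> k \<in> {1..N} \<Longrightarrow> e j = e k \<longleftrightarrow> j = k"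
  by (rule inj_on_eq_iff[OF bij_betw_imp_inj_on[OF coords]])

lemma e_cases:
  obtains k where "k \<in> {1..<N}" "i = e k" | "i = e N"
proof -
  obtain k where "k \<in> {1..N}" "i = e k"
    using coords by (metis UNIV_I bij_betw_imp_surj_on imageE)
  then show thesis
    using that(1)[of k] that(2) by (cases "k = N") auto
qed

text \<open>On the axis \<open>e 1\<close> the functions \<open>fe k\<close> are evaluated at \<open>0\<close>, where by hypothesis only
  the first derivative of \<open>fe 1\<close> and the value of \<open>fe 0\<close> survive.  Thus the vector field
  points in direction \<open>e N\<close>.  In the directions \<open>e 2\<close>, ..., \<open>e N\<close> its first
  derivative shifts \<open>e (k + 1)\<close> to \<open>e k\<close>, and its higher derivatives vanish.\<close>

lemma iterated_deriv_at_axis: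
  assumes "c > 0" and vs: "length vs \<le> N - 1" "\<And>v. v \<in> set vs \<Longrightarrow> v $ e 1 = 0"
  shows "k \<in> {1..<N} \<Longrightarrow> iterated_deriv \<phi> vs (c *\<^sub>R axis (e 1) 1) $ e k =
      (if length vs = 1 then c powr \<beta> * hd vs $ e (k + 1) else 0)"
    and "iterated_deriv \<phi> vs (c *\<^sub>R axis (e 1) 1) $ e N = (if vs = [] then c powr \<beta> else 0)"
proof -
  define h where "h i = fe (if i = e N then 0 else 1)" for i
  define \<sigma> where "\<sigma> i = (if i = e N then e N else e (Suc (inv_into {1..N} e i)))" for i
  have last: "h (e N) = fe 0" "\<sigma> (e N) = e N"
    by (simp_all add: h_def \<sigma>_def)
  have below: "h (e k) = fe 1" "\<sigma> (e k) = e (k + 1)" if "k \<in> {1..<N}" for k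
    using that e_eq_iff[of k N] coords
    by (auto simp: h_def \<sigma>_def bij_betw_def inv_into_f_f)
  have \<sigma>: "\<sigma> i \<noteq> e 1" for i
  proof (cases i rule: e_cases)
    case (1 k)
    then show ?thesis using below(2)[of k] e_eq_iff[of "k + 1" 1] by simp
  next
    case 2
    then show ?thesis using last(2) e_eq_iff[of N 1] N by simp
  qed
  have *: "iterated_deriv \<phi> vs (c *\<^sub>R axis (e 1) 1) $ i =
    c powr \<beta> * (deriv ^^ length vs) (h i) 0 * (\<Prod>v\<leftarrow>vs. v $ \<sigma> i)" for i
  proof -
    have "iterated_deriv \<phi> vs (c *\<^sub>R axis (e 1) 1) $ i =
      (c *\<^sub>R axis (e 1) 1 :: real ^ 'n) $ e 1 powr \<beta> *
      (deriv ^^ length vs) (h i) ((c *\<^sub>R axis (e 1) 1 :: real ^ 'n) $ \<sigma> i) * (\<Prod>v\<leftarrow>vs. v $ \<sigma> i)"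
    proof (rule iterated_deriv_powr_mult[where m = "N - 1"])
      fix x :: "real ^ 'n" and i assume "x $ e 1 > 0"
      then show "\<phi> x $ i = x $ e 1 powr \<beta> * h i (x $ \<sigma> i)"
        by (cases i rule: e_cases) (use \<phi> below last in auto)
    next
      fix i j x assume "j < N - 1"
      then show "(deriv ^^ j) (h i) differentiable at x"
        using fe(1)[of "if i = e N then 0 else 1"] by (auto simp: h_def Cb_def)
    qed (use assms in \<open>auto simp: axis_def\<close>)
    then show ?thesis
      using \<sigma>[of i] by (simp add: axis_def)
  qed
  show "iterated_deriv \<phi> vs (c *\<^sub>R axis (e 1) 1) $ e k =
      (if length vs = 1 then c powr \<beta> * hd vs $ e (k + 1) else 0)" if k: "k \<in> {1..<N}"
  proof (cases "length vs = 1")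
    case True
    then obtain v where "vs = [v]" by (auto simp: length_Suc_conv)
    show ?thesis
      unfolding * below[OF k] using fe(2)[of 1] \<open>vs = [v]\<close> by simp
  next
    case False
    then show ?thesis
      unfolding * below[OF k] using fe(3)[of 1 "length vs"] vs by simp
  qed
  show "iterated_deriv \<phi> vs (c *\<^sub>R axis (e 1) 1) $ e N = (if vs = [] then c powr \<beta> else 0)"
  proof (cases "vs = []")
    case True
    then show ?thesis unfolding * last using fe(2)[of 0] by simp
  next
    case False
    then show ?thesis
      unfolding * last using fe(3)[of 0 "length vs"] vs by simp
  qed
qed

text \<open>Iterating the derivative along ladders moves the direction from \<open>e N\<close> down to \<open>e 1\<close>,
  one step per vertex, and multiplies by \<open>profile powr \<beta>\<close> each time.  The formula is given for
  all ladders, including the one with \<open>N\<close> vertices, which is not a component of the controlled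
  path: there it is the integrand \<open>profile powr (N * \<beta>)\<close> in direction \<open>e 1\<close>, and the
  lemma \<open>comp_deriv_Y\<close> below can state the compatibility condition and the value of the
  integrand at once.\<close>

definition Y :: "forest \<Rightarrow> real \<Rightarrow> real ^ 'n" where
  "Y f t = (let n = vertices f in
    if f = ladder n then
      profile \<xi> t powr (if n = 0 then 1 else real n * \<beta>) *\<^sub>R axis (e (if n = 0 then 1 else N + 1 - n)) 1
    else 0)"

lemma Y_empty: "t < \<xi> \<Longrightarrow> Y {#} t = profile \<xi> t *\<^sub>R axis (e 1) 1"
  using profile_pos[OF \<xi>_pos, of t] by (simp add: Y_def)

lemma Y_graft:
  "Y (graft f) t = (if f = ladder (vertices f) then
    profile \<xi> t powr (real (Suc (vertices f)) * \<beta>) *\<^sub>R axis (e (N - vertices f)) 1 else 0)"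
  by (simp add: Y_def)

text \<open>A forest with one tree contributes a first derivative, which shifts the direction; a forest with
  at least two trees contributes a higher derivative, which is zero.  The components of nonempty
  forests with fewer than \<open>N\<close> vertices point in the directions \<open>e 2\<close>, ..., \<open>e N\<close>, so the
  derivative of the factor \<open>x $ e 1 powr \<beta>\<close> never enters.\<close>

lemma comp_deriv_Y:
  assumes f: "f \<in> forests (N - 1)" and t: "t < \<xi>"
  shows "comp_deriv \<phi> Y f t = Y (graft f) t"
proof -
  define c where "c = profile \<xi> t"
  have "c > 0" using profile_pos[OF \<xi>_pos t] by (simp add: c_def)
  have len: "vertices f \<le> N - 1" using f by (simp add: forests_def)
  have Y1: "Y {#} t = c *\<^sub>R axis (e 1) 1" using Y_empty[OF t] by (simp add: c_def)
  have dir: "Y {#\<tau>#} t $ e 1 = 0" if "\<tau> \<in># f" for \<tau>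
  proof -
    obtain g f' where g: "\<tau> = Node g" "f = add_mset \<tau> f'"
      using \<open>\<tau> \<in># f\<close> by (meson multi_member_split tree.exhaust)
    then have "Suc (vertices g) \<le> N - 1" using len by simp
    then have "e 1 \<noteq> e (N - vertices g)"
      using e_eq_iff[of 1 "N - vertices g"] by auto
    then show ?thesis
      using Y_graft[of g t] g by (simp add: graft_def axis_def)
  qed
  consider (empty) "f = {#}" | (single) \<tau> where "f = {#\<tau>#}" | (many) "size f \<ge> 2"
  proof -
    consider "size f = 0" | "size f = 1" | "size f \<ge> 2" by linarith
    then show thesis
      using that size_1_singleton_mset[of f] by cases auto
  qed
  then show ?thesis
  proof cases
    case empty
    have "comp_deriv \<phi> Y f t = iterated_deriv \<phi> [] (c *\<^sub>R axis (e 1) 1)"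
      by (simp add: comp_deriv_def empty Y1)
    also have "\<dots> = Y (graft f) t"
      unfolding vec_eq_iff
    proof
      fix i show "iterated_deriv \<phi> [] (c *\<^sub>R axis (e 1) 1) $ i = Y (graft f) t $ i"
        using iterated_deriv_at_axis[OF \<open>c > 0\<close>, of "[]"] e_eq_iff N
        by (cases i rule: e_cases) (auto simp: empty Y_graft c_def axis_def)
    qed
    finally show ?thesis .
  next
    case single
    obtain g where g: "\<tau> = Node g" by (cases \<tau>)
    then have fg: "f = graft g" by (simp add: single graft_def)
    have "{\<tau>s. mset \<tau>s = f} = {[\<tau>]}" by (auto simp: single)
    then have "comp_deriv \<phi> Y f t = iterated_deriv \<phi> [Y f t] (c *\<^sub>R axis (e 1) 1)"
      by (simp add: comp_deriv_def single Y1)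
    also have "\<dots> = Y (graft f) t"
      unfolding vec_eq_iff
    proof
      fix i
      have len1: "length [Y f t] \<le> N - 1" using N by simp
      have dir1: "v $ e 1 = 0" if "v \<in> set [Y f t]" for v using that dir single by auto
      have D1: "iterated_deriv \<phi> [Y f t] (c *\<^sub>R axis (e 1) 1) $ e k = c powr \<beta> * Y f t $ e (k + 1)"
        if "k \<in> {1..<N}" for k
        using iterated_deriv_at_axis(1)[OF \<open>c > 0\<close> len1 _ that] dir1 by (simp del: iterated_deriv.simps)
      have D2: "iterated_deriv \<phi> [Y f t] (c *\<^sub>R axis (e 1) 1) $ e N = 0"
        using iterated_deriv_at_axis(2)[OF \<open>c > 0\<close> len1] dir1 by (simp del: iterated_deriv.simps)
      have vg: "Suc (vertices g) \<le> N - 1" using len fg by simp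
      show "iterated_deriv \<phi> [Y f t] (c *\<^sub>R axis (e 1) 1) $ i = Y (graft f) t $ i"
      proof (cases i rule: e_cases)
        case (1 k)
        have "e (k + 1) = e (N - vertices g) \<longleftrightarrow> e k = e (N - vertices f)"
          using 1 vg e_eq_iff[of "k + 1" "N - vertices g"] e_eq_iff[of k "N - vertices f"]
          by (auto simp: fg)
        moreover have "c powr \<beta> * c powr (real (Suc (vertices g)) * \<beta>) =
          c powr (real (Suc (Suc (vertices g))) * \<beta>)"
          by (simp add: algebra_simps flip: powr_add)
        ultimately show ?thesis
          unfolding 1(2) D1[OF 1(1)]
          by (auto simp: fg Y_graft axis_def c_def simp del: of_nat_Suc)
      next
        case 2
        have "e N \<noteq> e (N - vertices f)"
          using vg e_eq_iff[of N "N - vertices f"] by (auto simp: fg)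
        then show ?thesis
          unfolding 2 D2 by (simp add: Y_graft axis_def)
      qed
    qed
    finally show ?thesis .
  next
    case many
    have "iterated_deriv \<phi> (map (\<lambda>\<tau>. Y {#\<tau>#} t) \<tau>s) (Y {#} t) = 0" if \<tau>s: "mset \<tau>s = f" for \<tau>s
      unfolding vec_eq_iff
    proof
      fix i
      have ge2: "length \<tau>s \<ge> 2" using \<tau>s many by auto
      have len2: "length (map (\<lambda>\<tau>. Y {#\<tau>#} t) \<tau>s) \<le> N - 1"
        using \<tau>s size_le_vertices[of f] len by auto
      have dir2: "v $ e 1 = 0" if "v \<in> set (map (\<lambda>\<tau>. Y {#\<tau>#} t) \<tau>s)" for v
        using that dir \<tau>s by auto
      show "iterated_deriv \<phi> (map (\<lambda>\<tau>. Y {#\<tau>#} t) \<tau>s) (Y {#} t) $ i = 0 $ i"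
        unfolding Y1
      proof (cases i rule: e_cases)
        case (1 k)
        then show "iterated_deriv \<phi> (map (\<lambda>\<tau>. Y {#\<tau>#} t) \<tau>s) (c *\<^sub>R axis (e 1) 1) $ i = 0 $ i"
          using iterated_deriv_at_axis(1)[OF \<open>c > 0\<close> len2, OF dir2 1(1)] ge2 by simp
      next
        case 2
        then show "iterated_deriv \<phi> (map (\<lambda>\<tau>. Y {#\<tau>#} t) \<tau>s) (c *\<^sub>R axis (e 1) 1) $ i = 0 $ i"
          using iterated_deriv_at_axis(2)[OF \<open>c > 0\<close> len2, OF dir2] ge2 by auto
      qed
    qed
    then have "comp_deriv \<phi> Y f t = 0" by (simp add: comp_deriv_def)
    moreover have "f \<noteq> ladder (vertices f)"
      using many size_ladder_le[of "vertices f"] by auto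
    ultimately show ?thesis by (simp add: Y_graft)
  qed
qed

lemma ladder_N: "ladder N = graft (ladder (N - 1))" "vertices (ladder N) = N"
  using N by (metis Suc_pred' ladder_simps(2) less_le_trans zero_less_numeral) simp

text \<open>All components are smooth before the explosion, hence Lipschitz on compact intervals, and all the
  required exponents are at most \<open>N * \<gamma> \<le> 1\<close>.\<close>

lemma controlled_Y:
  assumes \<gamma>: "0 < \<gamma>" "\<gamma> * real N \<le> 1"
  shows "controlled_rough_path N \<gamma> (primitive_path (ladder N)) {0..<\<xi>} Y"
  unfolding controlled_rough_path_def
proof (intro ballI allI impI)
  fix f a b assume f: "f \<in> forests (N - 1)" and ab: "{a..b} \<subseteq> {0..<\<xi>}"
  define q where "q = (real N - real (vertices f)) * \<gamma>"
  have q: "q \<le> 1"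
  proof -
    have "q \<le> real N * \<gamma>" unfolding q_def using \<gamma> by (intro mult_right_mono) auto
    then show ?thesis using \<gamma> by (simp add: mult.commute)
  qed
  have "\<exists>K\<ge>0. \<forall>s t. a \<le> s \<longrightarrow> s < t \<longrightarrow> t \<le> b \<longrightarrow> norm (Y f t - Y f s) \<le> K * (t - s)"
  proof (cases "a \<le> b \<and> f = ladder (vertices f)")
    case True
    then have "b < \<xi>" using ab by auto
    define p where "p = (if vertices f = 0 then 1 else real (vertices f) * \<beta>)"
    define w :: "real ^ 'n" where "w = axis (e (if vertices f = 0 then 1 else N + 1 - vertices f)) 1"
    have Y: "Y f r = profile \<xi> r powr p *\<^sub>R w" for r
      using True by (simp add: Y_def Let_def p_def w_def)
    have "norm w = 1" by (simp add: w_def norm_axis_1)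
    then have "norm (Y f t - Y f s) = \<bar>profile \<xi> t powr p - profile \<xi> s powr p\<bar>" for s t
      by (simp add: Y flip: scaleR_left_diff_distrib)
    then show ?thesis
      using lipschitz_powr_profile[OF \<xi>_pos \<open>b < \<xi>\<close>, of a p] by metis
  next
    case False
    then show ?thesis
      by (intro exI[of _ 0]) (auto simp: Y_def Let_def)
  qed
  then obtain K where K: "K \<ge> 0"
    "\<And>s t. a \<le> s \<Longrightarrow> s < t \<Longrightarrow> t \<le> b \<Longrightarrow> norm (Y f t - Y f s) \<le> K * (t - s)" by blast
  show "\<exists>C. \<forall>s t. a \<le> s \<longrightarrow> s < t \<longrightarrow> t \<le> b \<longrightarrow>
    norm (remainder N (primitive_path (ladder N)) Y f s t) /
      \<bar>t - s\<bar> powr ((real N - real (vertices f)) * \<gamma>) \<le> C"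
  proof (rule exI[of _ "K * (b - a) powr (1 - q)"], intro allI impI)
    fix s t assume st: "a \<le> s" "s < t" "t \<le> b"
    have "norm (Y f t - Y f s) / (t - s) powr q \<le> K * (t - s) / (t - s) powr q"
      using K(2)[OF st] by (intro divide_right_mono) auto
    also have "\<dots> \<le> K * (b - a) powr (1 - q)"
      using mult_left_mono[OF divide_powr_le[of "t - s" "b - a" q] K(1)] st q by simp
    finally show "norm (remainder N (primitive_path (ladder N)) Y f s t) /
      \<bar>t - s\<bar> powr ((real N - real (vertices f)) * \<gamma>) \<le> K * (b - a) powr (1 - q)"
      using st by (simp add: remainder_primitive_path[OF ladder_N f] q_def)
  qed
qed

text \<open>The only forest whose grafting is charged by the increments is the ladder with \<open>N - 1\<close>
  vertices, so the compensated sums collapse to ordinary left Riemann sums.\<close>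

lemma riemann_sum_Y:
  assumes ps: "is_partition s t ps" and t: "t < \<xi>"
  shows "riemann_sum N (primitive_path (ladder N)) \<phi> Y ps =
    (\<Sum>(u, v)\<leftarrow>partition_pairs ps. (v - u) * profile \<xi> u powr (real N * \<beta>)) *\<^sub>R axis (e 1) 1"
proof -
  have summand: "(\<Sum>f\<in>forests (N - 1). increment N (primitive_path (ladder N)) u v (graft f) *\<^sub>R comp_deriv \<phi> Y f u) =
    ((v - u) * profile \<xi> u powr (real N * \<beta>)) *\<^sub>R axis (e 1) 1" if "u < \<xi>" for u v
  proof -
    have mem: "ladder (N - 1) \<in> forests (N - 1)" by (simp add: forests_def)
    have "comp_deriv \<phi> Y (ladder (N - 1)) u = profile \<xi> u powr (real N * \<beta>) *\<^sub>R axis (e 1) 1"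
      using comp_deriv_Y[OF mem that] N by (simp add: Y_graft)
    then have "increment N (primitive_path (ladder N)) u v (graft f) *\<^sub>R comp_deriv \<phi> Y f u =
      (if f = ladder (N - 1) then ((v - u) * profile \<xi> u powr (real N * \<beta>)) *\<^sub>R axis (e 1) 1 else 0)" for f
      unfolding increment_primitive_path[OF ladder_N]
      by (auto simp: primitive_path_def dual_def ladder_N(1))
    then show ?thesis
      using mem by (simp add: finite_forests)
  qed
  have "u < \<xi>" if "(u, v) \<in> set (partition_pairs ps)" for u v
    using set_zip_leftD[OF that] partition_subset_interval[OF ps] t by auto
  then have "riemann_sum N (primitive_path (ladder N)) \<phi> Y ps =
    (\<Sum>(u, v)\<leftarrow>partition_pairs ps. ((v - u) * profile \<xi> u powr (real N * \<beta>)) *\<^sub>R axis (e 1) 1)"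
    unfolding riemann_sum_def
    by (intro arg_cong[where f = sum_list] map_cong refl) (clarify, intro summand)
  moreover have "(\<Sum>x\<leftarrow>xs. (case x of (u, v) \<Rightarrow> g u v *\<^sub>R w)) = (\<Sum>(u, v)\<leftarrow>xs. g u v) *\<^sub>R w"
    for xs :: "(real \<times> real) list" and g and w :: "real ^ 'n"
    by (induction xs) (auto simp: scaleR_left_distrib)
  ultimately show ?thesis by simp
qed

lemma rough_integral_Y:
  assumes t: "0 \<le> t" "t < \<xi>"
  shows "has_rough_integral N (primitive_path (ladder N)) \<phi> Y 0 t (Y {#} t - Y {#} 0)"
  unfolding has_rough_integral_def
proof (intro allI impI)
  fix \<epsilon> :: real assume "\<epsilon> > 0"
  let ?g = "\<lambda>u. profile \<xi> u powr (real N * \<beta>)"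
  have D: "(profile \<xi> has_real_derivative ?g u) (at u)" if "u \<in> {0..t}" for u
    using profile_deriv[OF \<xi>_pos, of u] that t by (simp add: \<xi>_exponent)
  have cont: "continuous_on {0..t} ?g"
  proof -
    have "continuous_on {0..t} (profile \<xi>)"
      using D DERIV_isCont by (intro continuous_at_imp_continuous_on) blast
    moreover have "profile \<xi> u \<noteq> 0" if "u \<in> {0..t}" for u
      using profile_pos[OF \<xi>_pos, of u] that t by auto
    ultimately show ?thesis by (intro continuous_intros) auto
  qed
  obtain \<delta> where \<delta>: "\<delta> > 0"
    "\<And>ps. is_partition 0 t ps \<Longrightarrow> \<forall>(u, v)\<in>set (partition_pairs ps). v - u < \<delta> \<Longrightarrow>
      \<bar>(\<Sum>(u, v)\<leftarrow>partition_pairs ps. (v - u) * ?g u) - (profile \<xi> t - profile \<xi> 0)\<bar> < \<epsilon>"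
    using left_riemann_sums[OF D cont \<open>\<epsilon> > 0\<close>] by blast
  have "norm (riemann_sum N (primitive_path (ladder N)) \<phi> Y ps - (Y {#} t - Y {#} 0)) < \<epsilon>"
    if ps: "is_partition 0 t ps" "\<forall>(u, v)\<in>set (partition_pairs ps). v - u < \<delta>" for ps
  proof -
    have "riemann_sum N (primitive_path (ladder N)) \<phi> Y ps - (Y {#} t - Y {#} 0) =
      ((\<Sum>(u, v)\<leftarrow>partition_pairs ps. (v - u) * ?g u) - (profile \<xi> t - profile \<xi> 0)) *\<^sub>R axis (e 1) 1"
      unfolding riemann_sum_Y[OF ps(1) t(2)]
      using t \<xi>_pos by (simp add: Y_empty algebra_simps)
    then show ?thesis
      using \<delta>(2)[OF ps] by (simp add: norm_axis_1)
  qed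
  then show "\<exists>\<delta>>0. \<forall>ps. is_partition 0 t ps \<longrightarrow> (\<forall>(u, v)\<in>set (partition_pairs ps). v - u < \<delta>) \<longrightarrow>
    norm (riemann_sum N (primitive_path (ladder N)) \<phi> Y ps - (Y {#} t - Y {#} 0)) < \<epsilon>"
    using \<delta>(1) by blast
qed

lemma explosion:
  assumes \<gamma>: "0 < \<gamma>" "\<gamma> * real N \<le> 1"
  shows "explodes_in_finite_time N \<gamma> (primitive_path (ladder N)) {x. x $ e 1 > 0} \<phi> (axis (e 1) 1)"
  unfolding explodes_in_finite_time_def
proof (intro exI conjI)
  show "\<xi> > 0" by (rule \<xi>_pos)
  show "rde_solution N \<gamma> (primitive_path (ladder N)) {x. x $ e 1 > 0} \<phi> {0..<\<xi>} Y"
    unfolding rde_solution_def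
  proof (intro conjI ballI impI)
    show "controlled_rough_path N \<gamma> (primitive_path (ladder N)) {0..<\<xi>} Y"
      by (rule controlled_Y[OF \<gamma>])
    fix t assume "t \<in> {0..<\<xi>}"
    then have t: "0 \<le> t" "t < \<xi>" by auto
    show "Y {#} t \<in> {x. x $ e 1 > 0}"
      using profile_pos[OF \<xi>_pos t(2)] by (simp add: Y_empty[OF t(2)] axis_def)
    show "has_rough_integral N (primitive_path (ladder N)) \<phi> Y 0 t (Y {#} t - Y {#} 0)"
      by (rule rough_integral_Y[OF t])
    show "Y (graft f) t = comp_deriv \<phi> Y f t" if "f \<in> forests (N - 2)" for f
      using that by (intro comp_deriv_Y[OF _ t(2), symmetric]) (auto simp: forests_def)
    show "Y f t = 0" if "size f \<ge> 2" for f
    proof -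
      have "f \<noteq> ladder (vertices f)" using that size_ladder_le[of "vertices f"] by auto
      then show ?thesis by (simp add: Y_def Let_def)
    qed
  qed
  show "Y {#} 0 = axis (e 1) 1"
    using \<xi>_pos by (simp add: Y_empty profile_0)
  have "\<forall>\<^sub>F t in at_left \<xi>. norm (Y {#} t) = profile \<xi> t"
  proof -
    have "\<forall>\<^sub>F t in at_left \<xi>. t < \<xi>"
      by (simp add: eventually_at_filter)
    then show ?thesis
      by eventually_elim (use profile_pos[OF \<xi>_pos] in \<open>simp add: Y_empty norm_axis_1 less_imp_le\<close>)
  qed
  then show "filterlim (\<lambda>t. norm (Y {#} t)) at_top (at_left \<xi>)"
    using profile_explodes[OF \<xi>_pos] by (simp cong: filterlim_cong)
qed

end

theorem mainTheorem6:
  fixes N :: nat and \<gamma> \<beta> :: real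
    and fe :: "nat \<Rightarrow> real \<Rightarrow> real"
    and e :: "nat \<Rightarrow> 'n::finite"
    and \<phi> :: "real ^ 'n \<Rightarrow> real ^ 'n"
    and X :: "real \<Rightarrow> functional"
  assumes N: "N \<ge> 2"
    and \<gamma>: "1 / (real N + 1) < \<gamma>" "\<gamma> \<le> 1 / real N"
    and \<beta>: "\<beta> > 1 / real N"
    and coords: "bij_betw e {1..N} (UNIV :: 'n set)"
    and fe: "\<And>k. k \<in> {0, 1} \<Longrightarrow> fe k \<in> Cb (N - 1)"
            "\<And>k. k \<in> {0, 1} \<Longrightarrow> (deriv ^^ k) (fe k) 0 = 1"
            "\<And>k j. k \<in> {0, 1} \<Longrightarrow> j \<in> {0..N - 1} - {k} \<Longrightarrow> (deriv ^^ j) (fe k) 0 = 0"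
    and \<phi>: "\<And>x k. x $ e 1 > 0 \<Longrightarrow> k \<in> {1..<N} \<Longrightarrow>
               \<phi> x $ e k = (x $ e 1) powr \<beta> * fe 1 (x $ e (k + 1))"
           "\<And>x. x $ e 1 > 0 \<Longrightarrow> \<phi> x $ e N = (x $ e 1) powr \<beta> * fe 0 (x $ e N)"
    and X: "\<And>t h. X t h = dual {#} h + t * dual ((graft ^^ N) {#}) h"
  shows "(\<forall>T>0. branched_rough_path N \<gamma> T X) \<and>
         explodes_in_finite_time N \<gamma> X {x. x $ e 1 > 0} \<phi> (axis (e 1) 1)"
proof -
  interpret ladder_rde N \<beta> fe e \<phi>
    by unfold_locales (fact N \<beta> coords fe \<phi>)+
  have X_eq: "X = primitive_path (ladder N)"
    by (intro ext) (simp add: X primitive_path_def ladder_def)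
  have "0 < 1 / (real N + 1)" by simp
  then have "0 < \<gamma>" using \<gamma>(1) by linarith
  moreover have "\<gamma> * real N \<le> 1" using \<gamma>(2) N by (simp add: field_simps)
  ultimately show ?thesis
    unfolding X_eq using branched_rough_path_primitive_path[OF ladder_N] explosion by blast
qed

end
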